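(* For all integers $n\ge 1$, the set $L_B(n+1)$ of all partitions of $n+1$ is the disjoint union $$L_B(n+1)=L_B(n)^{\downarrow_1}\;\sqcup\; S(n)^{\downarrow_2}\;\sqcup\; NS(n)^{\downarrow_2}\;\sqcup\;\bigsqcup_{n>\ell\ge 1}P_\ell(n)^{\downarrow_{\ell+2}} .$$
   Context: A partition of $n$ is a sequence of integers $a=(a_1,\dots,a_k)$ with $a_1\ge a_2\ge\dots\ge a_k>0$ and $\sum_i a_i=n$; by convention $a_j=0$ for $j>k$. $L_B(n)$ is the set of all partitions of $n$. For a partition $a$ and an index $i$, $a^{\downarrow_i}$ denotes the sequence obtained from $a$ by replacing $a_i$ by $a_i+1$ (adding one grain on the $i$-th column of its Ferrers diagram); for a set $S$ of partitions, $S^{\downarrow_i}=\{a^{\downarrow_i}: a\in S\}$. Let $d_i(a)=a_i-a_{i+1}$. The partition $a$ has a cliff at $i$ if $d_i(a)\ge 2$. It has a slippery plateau at $i$ if there is $m>i$ with $d_j(a)=0$ for all $i\le j<m$ and $d_m(a)=1$; the integer $m-i$ is the length of the slippery plateau. It has a non-slippery plateau at $i$ if there is $m>i$ with $d_j(a)=0$ for all $i\le j<m$ and $a$ has a cliff at $m$. It has a slippery step (resp. a non-slippery step) at $i$ if the sequence $a'=(a_1,\dots,a_{i-1},a_i-1,a_{i+1},\dots,a_k)$ is a partition with a slippery plateau (resp. a non-slippery plateau) at $i$. $S(n)$, $NS(n)$ and $P_\ell(n)$ denote the sets of partitions of $n$ having, respectively, a slippery step at $1$, a non-slippery step at $1$,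 and a slippery plateau of length $\ell$ at $1$.
   Formalization: The claim is stated for n ≥ 2 instead of n ≥ 1, because it fails at n = 1: the partition (1,1) of 2 lies in no piece, since S(1) and NS(1) are empty and there is no ℓ with 1 > ℓ ≥ 1. *)

theory Defs
  imports Main "HOL-Library.Disjoint_Sets"
begin

text \<open>
  A partition \<open>(a\<^sub>1, \<dots>, a\<^sub>k)\<close> is a function on \<open>nat\<close> carrying the convention \<open>a j = 0\<close> for
  \<open>j > k\<close>. Columns are numbered from 1; the unused value \<open>a 0\<close> is fixed to 0, so that a
  partition is represented by exactly one function.
\<close>

definition partitions :: "nat \<Rightarrow> (nat \<Rightarrow> nat) set" where
  "partitions n = {a. \<exists>k. (\<forall>i\<in>{1..<k}. a (i + 1) \<le> a i) \<and> (\<forall>i\<in>{1..k}. 0 < a i) \<and>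
     (\<forall>i. i \<notin> {1..k} \<longrightarrow> a i = 0) \<and> (\<Sum>i\<in>{1..k}. a i) = n}"

definition is_partition :: "(nat \<Rightarrow> nat) \<Rightarrow> bool" where
  "is_partition a \<longleftrightarrow> (\<exists>n. a \<in> partitions n)"

definition add_grain :: "nat \<Rightarrow> (nat \<Rightarrow> nat) \<Rightarrow> nat \<Rightarrow> nat" where
  "add_grain i a = a(i := a i + 1)"

definition d :: "nat \<Rightarrow> (nat \<Rightarrow> nat) \<Rightarrow> int" where
  "d i a = int (a i) - int (a (i + 1))"

definition cliff :: "(nat \<Rightarrow> nat) \<Rightarrow> nat \<Rightarrow> bool" where
  "cliff a i \<longleftrightarrow> d i a \<ge> 2"

definition slippery_plateau_of_length :: "nat \<Rightarrow> (nat \<Rightarrow> nat) \<Rightarrow> nat \<Rightarrow> bool" where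
  "slippery_plateau_of_length l a i \<longleftrightarrow>
     (\<exists>m>i. (\<forall>j\<in>{i..<m}. d j a = 0) \<and> d m a = 1 \<and> l = m - i)"

definition slippery_plateau :: "(nat \<Rightarrow> nat) \<Rightarrow> nat \<Rightarrow> bool" where
  "slippery_plateau a i \<longleftrightarrow> (\<exists>l. slippery_plateau_of_length l a i)"

definition non_slippery_plateau :: "(nat \<Rightarrow> nat) \<Rightarrow> nat \<Rightarrow> bool" where
  "non_slippery_plateau a i \<longleftrightarrow> (\<exists>m>i. (\<forall>j\<in>{i..<m}. d j a = 0) \<and> cliff a m)"

text \<open>
  The conjunct \<open>0 < a i\<close> below only rules out truncated subtraction: if \<open>a i = 0\<close>, then
  \<open>a\<^sub>i - 1\<close> is negative and the modified sequence is not a partition.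
\<close>

definition slippery_step :: "(nat \<Rightarrow> nat) \<Rightarrow> nat \<Rightarrow> bool" where
  "slippery_step a i \<longleftrightarrow> 0 < a i \<and>
     is_partition (a(i := a i - 1)) \<and> slippery_plateau (a(i := a i - 1)) i"

definition non_slippery_step :: "(nat \<Rightarrow> nat) \<Rightarrow> nat \<Rightarrow> bool" where
  "non_slippery_step a i \<longleftrightarrow> 0 < a i \<and>
     is_partition (a(i := a i - 1)) \<and> non_slippery_plateau (a(i := a i - 1)) i"

definition slippery_step_partitions :: "nat \<Rightarrow> (nat \<Rightarrow> nat) set" where
  "slippery_step_partitions n = {a \<in> partitions n. slippery_step a 1}"

definition non_slippery_step_partitions :: "nat \<Rightarrow> (nat \<Rightarrow> nat) set" where
  "non_slippery_step_partitions n = {a \<in> partitions n. non_slippery_step a 1}"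

definition plateau_partitions :: "nat \<Rightarrow> nat \<Rightarrow> (nat \<Rightarrow> nat) set" where
  "plateau_partitions l n = {a \<in> partitions n. slippery_plateau_of_length l a 1}"

text \<open>
  The decomposition of the partitions of \<open>n + 1\<close> fails for \<open>n = 1\<close>, where no piece
  contains \<open>(1, 1)\<close>: the only partition of 1 is \<open>(1)\<close>, which has neither a step nor a
  plateau at 1, and there is no \<open>l\<close> with \<open>1 > l \<ge> 1\<close>.
\<close>

lemma decomposition_fails_at_1:
  "partitions (1 + 1) \<noteq>
     add_grain 1 ` partitions 1 \<union> add_grain 2 ` slippery_step_partitions 1
     \<union> add_grain 2 ` non_slippery_step_partitions 1
     \<union> (\<Union>l\<in>{1..<1}. add_grain (l + 2) ` plateau_partitions l 1)"
proof -
  let ?b = "(\<lambda>i. if i = 1 \<or> i = 2 then 1 else 0) :: nat \<Rightarrow> nat"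
  have b: "?b \<in> partitions (1 + 1)"
    unfolding partitions_def
    by (intro CollectI exI[of _ 2]) (auto simp: numeral_2_eq_2)
  have one: "a 1 = 1 \<and> (\<forall>i. i \<noteq> 1 \<longrightarrow> a i = 0)" if a: "a \<in> partitions 1" for a
  proof -
    obtain k where pos: "\<forall>i\<in>{1..k}. 0 < a i" and zero: "\<forall>i. i \<notin> {1..k} \<longrightarrow> a i = 0"
      and total: "(\<Sum>i\<in>{1..k}. a i) = 1"
      using a unfolding partitions_def mem_Collect_eq by blast
    have "(\<Sum>i\<in>{1..k}. 1) \<le> (\<Sum>i\<in>{1..k}. a i)"
      by (rule sum_mono) (use pos in force)
    with total have "k \<le> 1" by simp
    moreover have "k \<noteq> 0" using total by (intro notI) simp
    ultimately have k: "k = 1" by simp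
    have "a 1 = 1" using total unfolding k by simp
    moreover have "a i = 0" if "i \<noteq> 1" for i
      using zero[rule_format, of i] that unfolding k by simp
    ultimately show ?thesis by blast
  qed
  have flat: "d j (a(1 := a 1 - 1)) = 0" if a: "a \<in> partitions 1" for a j
  proof -
    have "a(1 := a 1 - 1) = (\<lambda>_. 0)" using one[OF a] by (simp add: fun_eq_iff)
    then show ?thesis unfolding d_def by (metis diff_self)
  qed
  have "?b \<noteq> add_grain 1 a" if a: "a \<in> partitions 1" for a
  proof
    assume "?b = add_grain 1 a"
    from fun_cong[OF this, of 1] one[OF a] show False by (simp add: add_grain_def)
  qed
  then have "?b \<notin> add_grain 1 ` partitions 1" by blast
  moreover have "\<not> slippery_step a 1" if "a \<in> partitions 1" for a
    unfolding slippery_step_def slippery_plateau_def slippery_plateau_of_length_def flat[OF that]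
    by simp
  then have "slippery_step_partitions 1 = {}"
    unfolding slippery_step_partitions_def by blast
  moreover have "\<not> non_slippery_step a 1" if "a \<in> partitions 1" for a
    unfolding non_slippery_step_def non_slippery_plateau_def cliff_def flat[OF that]
    by simp
  then have "non_slippery_step_partitions 1 = {}"
    unfolding non_slippery_step_partitions_def by blast
  moreover have "{1..<1::nat} = {}" by simp
  ultimately show ?thesis
    unfolding \<open>slippery_step_partitions 1 = {}\<close> \<open>non_slippery_step_partitions 1 = {}\<close>
      \<open>{1..<1} = {}\<close> image_empty UN_empty Un_empty_right
    using b by blast
qed

end

theory Submission
  imports Defs
begin

text \<open>
  Let \<open>b\<close> be a partition of \<open>n + 1\<close> and let \<open>p\<close> be the number of columns equal to the first one.
  The last of these is the only one of them from which a grain can be taken. If \<open>p = 1\<close>, then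
  \<open>b\<close> lies in the first piece. If \<open>p = 2\<close>, then taking a grain from column 2 leaves a step at 1, and
  it is slippery or not according to the first descent further right; only for \<open>b = (1, 1)\<close> is there
  no such descent. If \<open>p \<ge> 3\<close>, then taking a grain from column \<open>p\<close> leaves a slippery plateau of
  length \<open>p - 2\<close>. So the piece containing \<open>b\<close> is determined by \<open>p\<close>.
\<close>

section \<open>Partitions as nonincreasing sequences of finite support\<close>

lemma nonincreasing_from_1:
  fixes a :: "nat \<Rightarrow> nat"
  assumes "\<forall>i\<ge>1. a (Suc i) \<le> a i" "1 \<le> i" "i \<le> j"
  shows "a j \<le> a i"
  using assms(3)
proof (induction j rule: dec_induct)
  case (step k)
  then show ?case using assms(1,2) by (meson le_trans)
qed simp

text \<open>The exact number of parts gives way to any bound \<open>N\<close> on the support, since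
  moving a grain may change the number of parts.\<close>

lemma partitions_iff:
  "a \<in> partitions n \<longleftrightarrow> a 0 = 0 \<and> (\<forall>i\<ge>1. a (Suc i) \<le> a i) \<and>
     (\<exists>N. (\<forall>i>N. a i = 0) \<and> sum a {1..N} = n)"
proof
  assume "a \<in> partitions n"
  then obtain k where k: "\<forall>i\<in>{1..<k}. a (i + 1) \<le> a i" "\<forall>i. i \<notin> {1..k} \<longrightarrow> a i = 0"
      "sum a {1..k} = n"
    unfolding partitions_def by blast
  have "a (Suc i) \<le> a i" if "1 \<le> i" for i
    using k(1,2) that by (cases "i < k") auto
  with k show "a 0 = 0 \<and> (\<forall>i\<ge>1. a (Suc i) \<le> a i) \<and>
     (\<exists>N. (\<forall>i>N. a i = 0) \<and> sum a {1..N} = n)"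
    by (intro conjI exI[of _ k]) auto
next
  assume *: "a 0 = 0 \<and> (\<forall>i\<ge>1. a (Suc i) \<le> a i) \<and>
     (\<exists>N. (\<forall>i>N. a i = 0) \<and> sum a {1..N} = n)"
  then obtain N where N: "\<forall>i>N. a i = 0" "sum a {1..N} = n" by (elim conjE exE)
  \<comment> \<open>The least bound on the support is the number of parts: a zero in a column
    \<open>i \<le> k\<close> would, by monotonicity, make \<open>i - 1\<close> a smaller
    bound.\<close>
  define k where "k = (LEAST k. \<forall>i>k. a i = 0)"
  have zero: "\<forall>i>k. a i = 0" unfolding k_def using N(1) by (rule LeastI)
  have "k \<le> N" unfolding k_def using N(1) by (rule Least_le)
  have pos: "0 < a i" if "1 \<le> i" "i \<le> k" for i
  proof (rule ccontr)
    assume "\<not> 0 < a i"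
    then have "\<forall>j>i - 1. a j = 0"
      using nonincreasing_from_1[of a i] * that(1) by fastforce
    then have "k \<le> i - 1" unfolding k_def by (rule Least_le)
    with that show False by simp
  qed
  have "sum a {1..k} = sum a {1..N}"
    using \<open>k \<le> N\<close> zero by (intro sum.mono_neutral_left) auto
  then show "a \<in> partitions n"
    unfolding partitions_def using * N(2) zero pos
    by (auto intro!: exI[of _ k] simp: not_le)
qed

lemma partitions_nonincreasing:
  assumes "a \<in> partitions n" "1 \<le> i" "i \<le> j"
  shows "a j \<le> a i"
  using assms nonincreasing_from_1 partitions_iff by metis

section \<open>Adding and removing a grain\<close>

lemma sum_add_grain:
  assumes "finite A" "i \<in> A"
  shows "sum (add_grain i a) A = sum a A + 1"
proof -
  have "sum (add_grain i a) A = add_grain i a i + sum (add_grain i a) (A - {i})"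
    using assms by (rule sum.remove)
  also have "sum (add_grain i a) (A - {i}) = sum a (A - {i})"
    by (rule sum.cong) (auto simp: add_grain_def)
  finally show ?thesis
    using sum.remove[OF assms, of a] by (simp add: add_grain_def)
qed

lemma add_grain_total:
  assumes "1 \<le> i"
  shows "(\<exists>N. (\<forall>j>N. add_grain i a j = 0) \<and> sum (add_grain i a) {1..N} = n + 1) \<longleftrightarrow>
    (\<exists>N. (\<forall>j>N. a j = 0) \<and> sum a {1..N} = n)"
proof
  assume "\<exists>N. (\<forall>j>N. add_grain i a j = 0) \<and> sum (add_grain i a) {1..N} = n + 1"
  then obtain N where N: "\<forall>j>N. add_grain i a j = 0" "sum (add_grain i a) {1..N} = n + 1"
    by blast
  then have "i \<le> N" by (metis add_grain_def add_eq_0_iff_both_eq_0 fun_upd_same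
      linorder_not_le one_neq_zero)
  with assms N show "\<exists>N. (\<forall>j>N. a j = 0) \<and> sum a {1..N} = n"
    by (intro exI[of _ N]) (auto simp: sum_add_grain, auto simp: add_grain_def split: if_splits)
next
  assume "\<exists>N. (\<forall>j>N. a j = 0) \<and> sum a {1..N} = n"
  then obtain N where N: "\<forall>j>N. a j = 0" "sum a {1..N} = n" by blast
  \<comment> \<open>The grain may land beyond the support of \<open>a\<close>, so the bound is
    enlarged to include \<open>i\<close>.\<close>
  have "sum a {1..N} = sum a {1..max N i}"
    using N(1) by (intro sum.mono_neutral_left) auto
  with assms N show "\<exists>N. (\<forall>j>N. add_grain i a j = 0) \<and> sum (add_grain i a) {1..N} = n + 1"
    by (intro exI[of _ "max N i"]) (auto simp: sum_add_grain, auto simp: add_grain_def)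
qed

lemma inj_add_grain: "inj (add_grain i)"
  by (rule injI) (metis add_grain_def add_right_cancel ext fun_upd_apply)

text \<open>A grain fits on column \<open>i\<close> exactly when the column to its left is higher,
  and can be taken off exactly when the column to its right is lower; the two moves are inverse. The
  case \<open>i = 1\<close> is separate because \<open>a 0\<close> is 0 by convention. The images of
  all pieces are computed by restricting this identity.\<close>

lemma add_grain_partitions:
  assumes "1 \<le> i"
  shows "add_grain i ` {a \<in> partitions n. i = 1 \<or> a i < a (i - 1)} =
    {b \<in> partitions (n + 1). b (i + 1) < b i}"
proof (intro equalityI subsetI)
  fix b assume "b \<in> add_grain i ` {a \<in> partitions n. i = 1 \<or> a i < a (i - 1)}"
  then obtain a where a: "a \<in> partitions n" "i = 1 \<or> a i < a (i - 1)" and b: "b = add_grain i a"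
    by blast
  have "b (Suc j) \<le> b j" if "1 \<le> j" for j
    using a(1)[unfolded partitions_iff] a(2) that unfolding b add_grain_def
    by (cases "Suc j = i") (auto intro: le_SucI)
  with a(1) b assms show "b \<in> {b \<in> partitions (n + 1). b (i + 1) < b i}"
    using add_grain_total[OF assms, of a n] unfolding partitions_iff
    by (auto simp: add_grain_def less_Suc_eq_le)
next
  fix b assume "b \<in> {b \<in> partitions (n + 1). b (i + 1) < b i}"
  then have b: "b \<in> partitions (n + 1)" "b (i + 1) < b i" by auto
  define a where "a = b(i := b i - 1)"
  \<comment> \<open>As \<open>b i\<close> exceeds \<open>b (i + 1)\<close>, it is positive and the
    subtraction in \<open>a\<close> is not truncated.\<close>
  have ba: "b = add_grain i a" using b(2) by (auto simp: a_def add_grain_def)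
  have "a (Suc j) \<le> a j" if "1 \<le> j" for j
    using b(1)[unfolded partitions_iff] b(2) that unfolding a_def
    by (auto intro: diff_le_self le_trans)
  then have "a \<in> partitions n"
    using b(1) add_grain_total[OF assms, of a n] assms unfolding ba partitions_iff
    by (auto simp: add_grain_def)
  moreover have "i = 1 \<or> a i < a (i - 1)"
  proof (cases "i = 1")
    case False
    then have "b i \<le> b (i - 1)" using assms by (intro partitions_nonincreasing[OF b(1)]) auto
    then show ?thesis using b(2) assms by (auto simp: a_def)
  qed simp
  ultimately show "b \<in> add_grain i ` {a \<in> partitions n. i = 1 \<or> a i < a (i - 1)}"
    using ba by blast
qed

lemma add_grain_1_partitions:
  "add_grain 1 ` partitions n = {b \<in> partitions (n + 1). b 2 < b 1}"
  using add_grain_partitions[of 1 n] by (simp add: numeral_2_eq_2)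

section \<open>Plateaus and steps at column 1\<close>

lemma flat_iff:
  assumes "i \<le> m"
  shows "(\<forall>j\<in>{i..<m}. d j a = 0) \<longleftrightarrow> (\<forall>j\<in>{i..m}. a j = a i)"
proof
  assume flat: "\<forall>j\<in>{i..<m}. d j a = 0"
  have "a j = a i" if "i \<le> j" "j \<le> m" for j
    using that
  proof (induction j rule: dec_induct)
    case (step k)
    then have "d k a = 0" using flat by simp
    with step show ?case by (simp add: d_def)
  qed simp
  then show "\<forall>j\<in>{i..m}. a j = a i" by (meson atLeastAtMost_iff)
next
  assume const: "\<forall>j\<in>{i..m}. a j = a i"
  show "\<forall>j\<in>{i..<m}. d j a = 0"
  proof
    fix j assume "j \<in> {i..<m}"
    then have "j \<in> {i..m}" "j + 1 \<in> {i..m}" by auto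
    with const have "a j = a i" "a (j + 1) = a i" by blast+
    then show "d j a = 0" by (simp add: d_def)
  qed
qed

text \<open>Of two different ends, the smaller would lie in the flat range of the larger.\<close>

lemma plateau_ends_uniquely:
  assumes "i < m" "\<forall>j\<in>{i..<m}. d j a = 0" "d m a \<noteq> 0"
    and "i < m'" "\<forall>j\<in>{i..<m'}. d j a = 0" "d m' a \<noteq> 0"
  shows "m = m'"
  using assms by (metis atLeastLessThan_iff less_imp_le linorder_neqE_nat)

lemma not_slippery_and_non_slippery:
  assumes "slippery_plateau a i"
  shows "\<not> non_slippery_plateau a i"
proof
  assume "non_slippery_plateau a i"
  then obtain m' where m': "i < m'" "\<forall>j\<in>{i..<m'}. d j a = 0" "2 \<le> d m' a"
    unfolding non_slippery_plateau_def cliff_def by blast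
  obtain m where m: "i < m" "\<forall>j\<in>{i..<m}. d j a = 0" "d m a = 1"
    using assms unfolding slippery_plateau_def slippery_plateau_of_length_def by blast
  have "m = m'" using m m' by (intro plateau_ends_uniquely[of i m a m']) auto
  with m m' show False by simp
qed

text \<open>The columns eventually vanish, so a positive start cannot stay constant forever. By
  monotonicity the first nonzero difference is positive: it is 1 (slippery) or at least 2 (a
  cliff).\<close>

lemma plateau_at_1_iff:
  assumes "a \<in> partitions n"
  shows "slippery_plateau a 1 \<or> non_slippery_plateau a 1 \<longleftrightarrow> a 1 = a 2 \<and> 0 < a 1"
proof
  assume "slippery_plateau a 1 \<or> non_slippery_plateau a 1"
  then obtain m where m: "1 < m" "\<forall>j\<in>{1..<m}. d j a = 0" "1 \<le> d m a"
    unfolding slippery_plateau_def slippery_plateau_of_length_def non_slippery_plateau_def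
      cliff_def by fastforce
  have const: "\<forall>j\<in>{1..m}. a j = a 1" using m(2) flat_iff[OF less_imp_le[OF m(1)]] by blast
  moreover have "2 \<in> {1..m}" "m \<in> {1..m}" using m(1) by auto
  ultimately have "a 2 = a 1" "a m = a 1" by blast+
  with m(3) show "a 1 = a 2 \<and> 0 < a 1" unfolding d_def by linarith
next
  assume *: "a 1 = a 2 \<and> 0 < a 1"
  obtain N where N: "\<forall>i>N. a i = 0" using assms unfolding partitions_iff by blast
  \<comment> \<open>Index 0 has to be excluded: \<open>d 0 a\<close> is minus \<open>a 1\<close>,
    which is nonzero here.\<close>
  let ?P = "\<lambda>m. 1 \<le> m \<and> d m a \<noteq> 0"
  have "\<exists>m. ?P m"
  proof (rule ccontr)
    assume "\<nexists>m. ?P m"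
    then have "\<forall>j\<in>{1..<Suc N}. d j a = 0" by auto
    moreover have "1 \<le> Suc N" "Suc N \<in> {1..Suc N}" by auto
    ultimately have "a (Suc N) = a 1" using flat_iff by blast
    with N * show False by simp
  qed
  define m where "m = (LEAST m. ?P m)"
  have m: "?P m" "\<And>k. k < m \<Longrightarrow> \<not> ?P k"
    unfolding m_def using LeastI_ex[OF \<open>\<exists>m. ?P m\<close>] not_less_Least[of _ ?P] by blast+
  have "d 1 a = int (a 1) - int (a 2)" by (simp only: d_def one_add_one)
  then have "d 1 a = 0" using * by linarith
  with m(1) have "m \<noteq> 1" by blast
  with m(1) have "1 < m" by linarith
  have "0 \<le> d m a"
    using partitions_nonincreasing[OF assms, of m "m + 1"] m(1) unfolding d_def by linarith
  then consider "d m a = 1" | "2 \<le> d m a" using m(1) by linarith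
  moreover have "\<forall>j\<in>{1..<m}. d j a = 0" using m(2) by (meson atLeastLessThan_iff)
  ultimately show "slippery_plateau a 1 \<or> non_slippery_plateau a 1"
    using \<open>1 < m\<close>
    unfolding slippery_plateau_def slippery_plateau_of_length_def non_slippery_plateau_def
      cliff_def by cases blast+
qed

text \<open>This is \<open>plateau_at_1_iff\<close> for the sequence with one grain taken from
  column 1.\<close>

lemma step_at_1_iff:
  assumes "a \<in> partitions n"
  shows "slippery_step a 1 \<or> non_slippery_step a 1 \<longleftrightarrow> a 1 = a 2 + 1 \<and> 0 < a 2"
proof
  assume "slippery_step a 1 \<or> non_slippery_step a 1"
  then have "0 < a 1" "\<exists>m. a(1 := a 1 - 1) \<in> partitions m"
      "slippery_plateau (a(1 := a 1 - 1)) 1 \<or> non_slippery_plateau (a(1 := a 1 - 1)) 1"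
    unfolding slippery_step_def non_slippery_step_def is_partition_def by blast+
  then show "a 1 = a 2 + 1 \<and> 0 < a 2"
    using plateau_at_1_iff[of "a(1 := a 1 - 1)"] by auto
next
  assume *: "a 1 = a 2 + 1 \<and> 0 < a 2"
  \<comment> \<open>Writing \<open>n\<close> as \<open>k + 1\<close> lets
    \<open>add_grain_1_partitions\<close> supply the partition \<open>a'\<close> that remains once
    the grain is removed.\<close>
  have "n \<noteq> 0"
  proof
    assume "n = 0"
    then obtain N where N: "\<forall>i>N. a i = 0" "sum a {1..N} = 0"
      using assms unfolding partitions_iff by blast
    then have "a 1 = 0" by (cases "1 \<le> N") auto
    with * show False by simp
  qed
  then obtain k where "n = k + 1" using not0_implies_Suc by auto
  with assms * obtain a' where a': "a' \<in> partitions k" "a = add_grain 1 a'"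
    using add_grain_1_partitions[of k] by (smt (verit) Suc_eq_plus1 image_iff lessI mem_Collect_eq)
  then have "a(1 := a 1 - 1) = a'" by (auto simp: add_grain_def)
  with a' * show "slippery_step a 1 \<or> non_slippery_step a 1"
    using plateau_at_1_iff[of a' k]
    unfolding slippery_step_def non_slippery_step_def is_partition_def
    by (auto simp: add_grain_def)
qed

lemma step_partitions_disjoint:
  "slippery_step_partitions n \<inter> non_slippery_step_partitions n = {}"
  using not_slippery_and_non_slippery
  unfolding slippery_step_partitions_def non_slippery_step_partitions_def
    slippery_step_def non_slippery_step_def by blast

section \<open>Images of the pieces\<close>

lemma image_Collect_image_prop: "f ` {a \<in> A. Q (f a)} = {b \<in> f ` A. Q b}"
  by blast

text \<open>The two kinds of step are taken together because their union depends on columns 1 and 2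
  alone; which kind occurs depends on the first descent further right.\<close>

lemma add_grain_step_partitions:
  "add_grain 2 ` (slippery_step_partitions n \<union> non_slippery_step_partitions n) =
    {b \<in> partitions (n + 1). b 1 = b 2 \<and> b 3 < b 2 \<and> 2 \<le> b 2}"
proof -
  have "slippery_step_partitions n \<union> non_slippery_step_partitions n =
      {a \<in> partitions n. a 1 = a 2 + 1 \<and> 0 < a 2}"
    unfolding slippery_step_partitions_def non_slippery_step_partitions_def
    using step_at_1_iff by blast
  \<comment> \<open>The condition splits into the one of \<open>add_grain_partitions\<close> at
    \<open>i = 2\<close>, kept in its literal form, and one on the image, which passes through the
    map.\<close>
  also have "\<dots> = {a \<in> {a \<in> partitions n. (2::nat) = 1 \<or> a 2 < a (2 - 1)}.
      add_grain 2 a 1 = add_grain 2 a 2 \<and> 2 \<le> add_grain 2 a 2}"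
    by (auto simp: add_grain_def)
  finally have "add_grain 2 ` (slippery_step_partitions n \<union> non_slippery_step_partitions n) =
      {b \<in> add_grain 2 ` {a \<in> partitions n. (2::nat) = 1 \<or> a 2 < a (2 - 1)}. b 1 = b 2 \<and> 2 \<le> b 2}"
    using image_Collect_image_prop[of "add_grain 2" _ "\<lambda>b. b 1 = b 2 \<and> 2 \<le> b 2"]
    by (simp only:)
  also have "\<dots> = {b \<in> {b \<in> partitions (n + 1). b (2 + 1) < b 2}. b 1 = b 2 \<and> 2 \<le> b 2}"
    using add_grain_partitions[of 2 n] by (simp only: one_le_numeral)
  finally show ?thesis by auto
qed

text \<open>Length counts differences, not columns: the plateau occupies columns 1 to
  \<open>l + 1\<close>, and the unit drop leads to column \<open>l + 2\<close>.\<close>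

lemma plateau_partitions_iff:
  assumes "1 \<le> l"
  shows "a \<in> plateau_partitions l n \<longleftrightarrow>
    a \<in> partitions n \<and> (\<forall>j\<in>{1..l + 1}. a j = a 1) \<and> a 1 = a (l + 2) + 1"
proof -
  have "slippery_plateau_of_length l a 1 \<longleftrightarrow>
      (\<forall>j\<in>{1..<l + 1}. d j a = 0) \<and> d (l + 1) a = 1"
    unfolding slippery_plateau_of_length_def using assms by (auto intro!: exI[of _ "l + 1"])
  also have "\<dots> \<longleftrightarrow> (\<forall>j\<in>{1..l + 1}. a j = a 1) \<and> d (l + 1) a = 1"
    using flat_iff[of 1 "l + 1" a] by simp
  also have "\<dots> \<longleftrightarrow> (\<forall>j\<in>{1..l + 1}. a j = a 1) \<and> a 1 = a (l + 2) + 1"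
  proof (rule conj_cong[OF refl])
    assume "\<forall>j\<in>{1..l + 1}. a j = a 1"
    moreover have "l + 1 \<in> {1..l + 1}" by simp
    ultimately have "a (l + 1) = a 1" by blast
    then show "d (l + 1) a = 1 \<longleftrightarrow> a 1 = a (l + 2) + 1" by (auto simp: d_def)
  qed
  finally show ?thesis unfolding plateau_partitions_def by blast
qed

text \<open>The grain fills the unit drop, so the leading block grows to exactly
  \<open>l + 2\<close> equal columns, from which \<open>l\<close> can be read off.\<close>

lemma add_grain_plateau_partitions:
  assumes "1 \<le> l"
  shows "add_grain (l + 2) ` plateau_partitions l n =
    {b \<in> partitions (n + 1). (\<forall>j\<in>{1..l + 2}. b j = b 1) \<and> b (l + 3) < b (l + 2)}"
proof -
  have "a \<in> plateau_partitions l n \<longleftrightarrow>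
      a \<in> partitions n \<and> (l + 2 = 1 \<or> a (l + 2) < a (l + 2 - 1)) \<and>
      (\<forall>j\<in>{1..l + 2}. add_grain (l + 2) a j = add_grain (l + 2) a 1)" for a
  proof -
    have "{1..l + 2} = insert (l + 2) {1..l + 1}" by auto
    moreover have "a 1 = a (l + 1)" if "\<forall>j\<in>{1..l + 1}. a j = a 1"
    proof -
      have "l + 1 \<in> {1..l + 1}" by simp
      with that show ?thesis by metis
    qed
    moreover have "add_grain (l + 2) a j = a j" if "j \<in> {1..l + 1}" for j
      using that by (simp add: add_grain_def)
    moreover have "add_grain (l + 2) a 1 = a 1" "add_grain (l + 2) a (l + 2) = a (l + 2) + 1"
      by (simp_all add: add_grain_def)
    moreover have "l + 2 - 1 = l + 1" by simp
    ultimately show ?thesis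
      unfolding plateau_partitions_iff[OF assms] by (smt (verit) insert_iff less_add_one)
  qed
  then have "plateau_partitions l n = {a \<in> {a \<in> partitions n. l + 2 = 1 \<or> a (l + 2) < a (l + 2 - 1)}.
      \<forall>j\<in>{1..l + 2}. add_grain (l + 2) a j = add_grain (l + 2) a 1}"
    by blast
  then have "add_grain (l + 2) ` plateau_partitions l n =
      {b \<in> add_grain (l + 2) ` {a \<in> partitions n. l + 2 = 1 \<or> a (l + 2) < a (l + 2 - 1)}.
        \<forall>j\<in>{1..l + 2}. b j = b 1}"
    using image_Collect_image_prop[of "add_grain (l + 2)" _ "\<lambda>b. \<forall>j\<in>{1..l + 2}. b j = b 1"]
    by (simp only:)
  also have "\<dots> = {b \<in> {b \<in> partitions (n + 1). b (l + 2 + 1) < b (l + 2)}.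
      \<forall>j\<in>{1..l + 2}. b j = b 1}"
    using add_grain_partitions[of "l + 2" n] by (simp only: le_add2 one_le_numeral trans_le_add2)
  also have "l + 2 + 1 = l + 3" by simp
  finally show ?thesis by blast
qed

section \<open>The leading block of equal columns\<close>

lemma column_count_le:
  assumes "b \<in> partitions n" "0 < b p"
  shows "p \<le> n"
proof -
  obtain N where N: "\<forall>i>N. b i = 0" "sum b {1..N} = n"
    using assms(1) unfolding partitions_iff by blast
  have "p \<le> N" using N(1) assms(2) by (metis less_numeral_extra(3) not_le)
  have "p = (\<Sum>i\<in>{1..p}. 1)" by simp
  also have "\<dots> \<le> sum b {1..p}"
    using partitions_nonincreasing[OF assms(1), of _ p] assms(2)
    by (intro sum_mono) (force simp: Suc_le_eq intro: less_le_trans)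
  also have "\<dots> \<le> sum b {1..N}"
    using \<open>p \<le> N\<close> by (intro sum_mono2) auto
  finally show ?thesis using N(2) by simp
qed

text \<open>This isolates the exceptional partition (1, 1), where taking a grain from column 2
  leaves no step at 1.\<close>

lemma partition_1_1_size:
  assumes "b \<in> partitions n" "b 1 = 1" "b 2 = 1" "b 3 = 0"
  shows "n = 2"
proof -
  obtain N where N: "\<forall>i>N. b i = 0" "sum b {1..N} = n"
    using assms(1) unfolding partitions_iff by blast
  have "2 \<le> N" using N(1) assms(3) by (metis not_le zero_neq_one)
  have "b i = 0" if "3 \<le> i" for i
    using partitions_nonincreasing[OF assms(1), of 3 i] that assms(4) by simp
  then have "sum b {1..2} = sum b {1..N}"
    using \<open>2 \<le> N\<close> by (intro sum.mono_neutral_left) auto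
  with N(2) assms show ?thesis by (simp add: numeral_2_eq_2)
qed

lemma first_plateau:
  assumes "b \<in> partitions n" "0 < n"
  obtains p where "1 \<le> p" "\<forall>j\<in>{1..p}. b j = b 1" "b (p + 1) < b p" "p \<le> n"
proof -
  obtain N where N: "\<forall>i>N. b i = 0" "sum b {1..N} = n"
    using assms(1) unfolding partitions_iff by blast
  have "0 < b 1"
  proof (rule ccontr)
    assume "\<not> 0 < b 1"
    then have "\<forall>i\<in>{1..N}. b i = 0"
      using partitions_nonincreasing[OF assms(1), of 1] by fastforce
    with N(2) assms(2) show False by simp
  qed
  \<comment> \<open>Testing column \<open>p + 1\<close> makes the condition false at
    \<open>p = 0\<close>, so the least solution is at least 1 and is the number of columns in the
    leading block.\<close>
  let ?P = "\<lambda>p. b (p + 1) \<noteq> b 1"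
  have "?P N" using N(1) \<open>0 < b 1\<close> by simp
  then have "\<exists>p. ?P p" by blast
  define p where "p = (LEAST p. ?P p)"
  have p: "?P p" "\<And>k. k < p \<Longrightarrow> \<not> ?P k"
    unfolding p_def using LeastI_ex[OF \<open>\<exists>p. ?P p\<close>] not_less_Least[of _ ?P] by blast+
  have "p \<noteq> 0" using p(1) by (metis add_0)
  then have "1 \<le> p" by simp
  have const: "b j = b 1" if "j \<in> {1..p}" for j
  proof -
    have "j - 1 < p" "j - 1 + 1 = j" using that by auto
    with p(2)[of "j - 1"] show ?thesis by metis
  qed
  have "b (p + 1) < b p"
    using partitions_nonincreasing[OF assms(1), of p "p + 1"] p(1) const[of p] \<open>1 \<le> p\<close>
    by (metis atLeastAtMost_iff le_add1 le_neq_implies_less order_refl)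
  moreover from this have "p \<le> n" using column_count_le[OF assms(1), of p] by simp
  ultimately show ?thesis using that const \<open>1 \<le> p\<close> by blast
qed

section \<open>Covering and disjointness of the pieces\<close>

theorem theorem1:
  fixes n :: nat
  assumes "n \<ge> 2"
  shows "partitions (n + 1) =
      add_grain 1 ` partitions n
      \<union> add_grain 2 ` slippery_step_partitions n
      \<union> add_grain 2 ` non_slippery_step_partitions n
      \<union> (\<Union>l\<in>{1..<n}. add_grain (l + 2) ` plateau_partitions l n)
    \<and> add_grain 1 ` partitions n \<inter> add_grain 2 ` slippery_step_partitions n = {}
    \<and> add_grain 1 ` partitions n \<inter> add_grain 2 ` non_slippery_step_partitions n = {}
    \<and> add_grain 2 ` slippery_step_partitions n \<inter> add_grain 2 ` non_slippery_step_partitions n = {}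
    \<and> (\<forall>l\<in>{1..<n}.
        add_grain 1 ` partitions n \<inter> add_grain (l + 2) ` plateau_partitions l n = {}
        \<and> add_grain 2 ` slippery_step_partitions n \<inter> add_grain (l + 2) ` plateau_partitions l n = {}
        \<and> add_grain 2 ` non_slippery_step_partitions n \<inter> add_grain (l + 2) ` plateau_partitions l n = {})
    \<and> disjoint_family_on (\<lambda>l. add_grain (l + 2) ` plateau_partitions l n) {1..<n}"
proof -
  let ?A = "add_grain 1 ` partitions n"
  let ?S = "add_grain 2 ` slippery_step_partitions n"
  let ?NS = "add_grain 2 ` non_slippery_step_partitions n"
  let ?P = "\<lambda>l. add_grain (l + 2) ` plateau_partitions l n"
  have A: "?A = {b \<in> partitions (n + 1). b 2 < b 1}"
    by (rule add_grain_1_partitions)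
  have S: "?S \<union> ?NS = {b \<in> partitions (n + 1). b 1 = b 2 \<and> b 3 < b 2 \<and> 2 \<le> b 2}"
    using add_grain_step_partitions[of n] by (simp add: image_Un)
  have P: "?P l = {b \<in> partitions (n + 1). (\<forall>j\<in>{1..l + 2}. b j = b 1) \<and> b (l + 3) < b (l + 2)}"
    if "l \<in> {1..<n}" for l
    using that by (intro add_grain_plateau_partitions) simp
  \<comment> \<open>Since \<open>l \<ge> 1\<close>, the block has at least three columns, whereas
    members of \<open>?A\<close> drop after column 1 and members of \<open>?S\<close> and
    \<open>?NS\<close> after column 2.\<close>
  have flat: "b 2 = b 1 \<and> b 3 = b 2" if "b \<in> ?P l" "l \<in> {1..<n}" for b l
  proof -
    have "\<forall>j\<in>{1..l + 2}. b j = b 1" using that P by blast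
    moreover have "2 \<in> {1..l + 2}" "3 \<in> {1..l + 2}" using that(2) by auto
    ultimately show ?thesis by metis
  qed
  have cover: "b \<in> ?A \<union> (?S \<union> ?NS) \<union> (\<Union>l\<in>{1..<n}. ?P l)" if b: "b \<in> partitions (n + 1)" for b
  proof -
    have "0 < n + 1" by simp
    then obtain p where p: "1 \<le> p" "\<forall>j\<in>{1..p}. b j = b 1" "b (p + 1) < b p" "p \<le> n + 1"
      by (rule first_plateau[OF b])
    consider "p = 1" | "p = 2" | "3 \<le> p" using p(1) by linarith
    then show ?thesis
    proof cases
      case 1
      then have "b 2 < b 1" using p(3) by (metis one_add_one)
      with b show ?thesis unfolding A by blast
    next
      case 2
      then have "2 \<in> {1..p}" by simp
      then have "b 1 = b 2" using p(2) by metis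
      moreover have "b 3 < b 2" using p(3)[unfolded 2] by simp
      ultimately have b12: "b 1 = b 2" "b 3 < b 2" .
      have "2 \<le> b 2"
      proof (rule ccontr)
        assume "\<not> 2 \<le> b 2"
        then have "b 1 = 1" "b 2 = 1" "b 3 = 0" using b12 by linarith+
        then have "n + 1 = 2" by (rule partition_1_1_size[OF b])
        with assms show False by simp
      qed
      with b b12 show ?thesis unfolding S by blast
    next
      case 3
      define l where "l = p - 2"
      have pl: "p = l + 2" "p + 1 = l + 3" using 3 by (auto simp: l_def)
      \<comment> \<open>The bound \<open>p \<le> n + 1\<close> on the number of columns is exactly
        what gives \<open>l < n\<close>.\<close>
      have l: "l \<in> {1..<n}" using 3 p(4) by (auto simp: l_def)
      have "b \<in> ?P l" unfolding P[OF l]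
        using b p(2)[unfolded pl(1)] p(3)[unfolded pl(2), unfolded pl(1)] by blast
      with l show ?thesis by blast
    qed
  qed
  have disjoint_P: "disjoint_family_on ?P {1..<n}"
    unfolding disjoint_family_on_def
  proof (intro ballI impI)
    \<comment> \<open>Members of \<open>?P k\<close> drop from column \<open>k + 2\<close> to
      \<open>k + 3\<close>; for \<open>k < l\<close> both columns lie inside the constant block of
      members of \<open>?P l\<close>.\<close>
    have disjoint: "?P k \<inter> ?P l = {}" if "k \<in> {1..<n}" "l \<in> {1..<n}" "k < l" for k l
    proof -
      have "b (k + 3) = b (k + 2)" if "b \<in> ?P l" for b
      proof -
        have "\<forall>j\<in>{1..l + 2}. b j = b 1" using that P \<open>l \<in> {1..<n}\<close> by blast
        moreover have "k + 2 \<in> {1..l + 2}" "k + 3 \<in> {1..l + 2}" using \<open>k < l\<close> by auto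
        ultimately show ?thesis by metis
      qed
      moreover have "b (k + 3) < b (k + 2)" if "b \<in> ?P k" for b
        using that P \<open>k \<in> {1..<n}\<close> by blast
      ultimately show ?thesis by (metis disjoint_iff less_irrefl)
    qed
    fix k l assume kl: "k \<in> {1..<n}" "l \<in> {1..<n}" "k \<noteq> l"
    then consider "k < l" | "l < k" by linarith
    then show "?P k \<inter> ?P l = {}"
      using disjoint kl by cases blast+
  qed
  \<comment> \<open>Only the union of these two images has been described, so their disjointness is
    carried over from the two sets of steps by injectivity of \<open>add_grain 2\<close>.\<close>
  have S_NS: "?S \<inter> ?NS = {}"
    unfolding image_Int[OF inj_add_grain, symmetric] step_partitions_disjoint by simp
  have A_S: "?A \<inter> (?S \<union> ?NS) = {}" unfolding A S by auto
  have A_P: "?A \<inter> ?P l = {}" and S_P: "(?S \<union> ?NS) \<inter> ?P l = {}" if "l \<in> {1..<n}" for l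
    using flat[OF _ that] unfolding A S disjoint_iff
    by (metis (mono_tags, lifting) less_irrefl mem_Collect_eq)+
  have "?A \<union> (?S \<union> ?NS) \<union> (\<Union>l\<in>{1..<n}. ?P l) \<subseteq> partitions (n + 1)"
    unfolding A S using P by blast
  then have "partitions (n + 1) = ?A \<union> (?S \<union> ?NS) \<union> (\<Union>l\<in>{1..<n}. ?P l)"
    by (intro equalityI subsetI) (rule cover, assumption, erule subsetD)
  then have union: "partitions (n + 1) = ?A \<union> ?S \<union> ?NS \<union> (\<Union>l\<in>{1..<n}. ?P l)"
    by (simp only: Un_assoc)
  show ?thesis
    using A_S S_NS A_P S_P disjoint_P
    by (intro conjI ballI union) (simp_all only: Int_Un_distrib Int_Un_distrib2 Un_empty)
qed

end
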